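(* For $n\ge 0$ let $g_n(x)=\sum_{k=0}^{n}g(n,k)x^k$ with $g(n,k)=\binom{n}{k}^3$ be the Franel polynomial, and let $$\mu_n=\frac{g_n'(1)}{g_n(1)},\qquad \sigma_n^2=\frac{g_n''(1)}{g_n(1)}+\mu_n-\mu_n^2 .$$ Then the coefficients $g(n,k)$ are asymptotically normal by local and central limit theorems with mean $\mu_n$ and variance $\sigma_n^2$, where, as $n\to\infty$, $$\mu_n\sim\frac n2,\qquad \sigma_n^2\sim\frac n{12}.$$
   Context: For nonnegative numbers $a(n,k)$ ($0\le k\le n$, and $a(n,k)=0$ for other $k$), let $p(n,k)=a(n,k)/\sum_{j=0}^n a(n,j)$. The numbers $a(n,k)$ are asymptotically normal with mean $\mu_n$ and variance $\sigma_n^2$ by a central limit theorem if $$\lim_{n\to\infty}\sup_{x\in\mathbb{R}}\Big|\sum_{k\le\mu_n+x\sigma_n}p(n,k)-\frac1{\sqrt{2\pi}}\int_{-\infty}^x e^{-t^2/2}\,dt\Big|=0,$$ and by a local limit theorem (on $\mathbb{R}$) if $$\lim_{n\to\infty}\sup_{x\in\mathbb{R}}\Big|\sigma_n\,p(n,\lfloor\mu_n+x\sigma_n\rfloor)-\frac1{\sqrt{2\pi}}e^{-x^2/2}\Big|=0.$$ Here $u_n\sim v_n$ means $u_n/v_n\to1$ as $n\to\infty$. *)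

theory Defs
  imports "HOL-Probability.Probability" "HOL-Library.Landau_Symbols"
    "HOL-Computational_Algebra.Polynomial"
begin

text \<open>The second index is an integer because the local limit theorem evaluates
  \<open>p(n, \<lfloor>\<mu>\<^sub>n + x \<sigma>\<^sub>n\<rfloor>)\<close> for all real \<open>x\<close>, including where the floor is negative or
  exceeds \<open>n\<close>; there the value is 0 by convention, whatever the values of \<open>a n\<close> beyond \<open>n\<close>.\<close>

definition norm_coeff :: "(nat \<Rightarrow> nat \<Rightarrow> real) \<Rightarrow> nat \<Rightarrow> int \<Rightarrow> real" where
  "norm_coeff a n k =
     (if 0 \<le> k \<and> k \<le> int n then a n (nat k) / (\<Sum>j=0..n. a n j) else 0)"

text \<open>In the next two definitions \<open>\<mu>\<close> is the mean and \<open>v\<close> the variance, so that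
  \<open>\<sigma>\<^sub>n = sqrt (v n)\<close>. They are meant for nonnegative \<open>a\<close>; the real suprema are then taken
  over bounded sets, as shown at the end of the theory.\<close>

definition clt_error ::
    "(nat \<Rightarrow> nat \<Rightarrow> real) \<Rightarrow> (nat \<Rightarrow> real) \<Rightarrow> (nat \<Rightarrow> real) \<Rightarrow> nat \<Rightarrow> real \<Rightarrow> real" where
  "clt_error a \<mu> v n x =
     \<bar>(\<Sum>k | k \<in> {0..int n} \<and> real_of_int k \<le> \<mu> n + x * sqrt (v n). norm_coeff a n k)
       - 1 / sqrt (2 * pi) * (LINT t:{..x}|lborel. exp (- t\<^sup>2 / 2))\<bar>"

definition llt_error ::
    "(nat \<Rightarrow> nat \<Rightarrow> real) \<Rightarrow> (nat \<Rightarrow> real) \<Rightarrow> (nat \<Rightarrow> real) \<Rightarrow> nat \<Rightarrow> real \<Rightarrow> real" where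
  "llt_error a \<mu> v n x =
     \<bar>sqrt (v n) * norm_coeff a n \<lfloor>\<mu> n + x * sqrt (v n)\<rfloor>
       - 1 / sqrt (2 * pi) * exp (- x\<^sup>2 / 2)\<bar>"

definition asymp_normal_clt ::
    "(nat \<Rightarrow> nat \<Rightarrow> real) \<Rightarrow> (nat \<Rightarrow> real) \<Rightarrow> (nat \<Rightarrow> real) \<Rightarrow> bool" where
  "asymp_normal_clt a \<mu> v \<longleftrightarrow> (\<lambda>n. SUP x. clt_error a \<mu> v n x) \<longlonglongrightarrow> 0"

definition asymp_normal_llt ::
    "(nat \<Rightarrow> nat \<Rightarrow> real) \<Rightarrow> (nat \<Rightarrow> real) \<Rightarrow> (nat \<Rightarrow> real) \<Rightarrow> bool" where
  "asymp_normal_llt a \<mu> v \<longleftrightarrow> (\<lambda>n. SUP x. llt_error a \<mu> v n x) \<longlonglongrightarrow> 0"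

definition franel_coeff :: "nat \<Rightarrow> nat \<Rightarrow> real" where
  "franel_coeff n k = real (n choose k) ^ 3"

definition franel_poly :: "nat \<Rightarrow> real poly" where
  "franel_poly n = (\<Sum>k=0..n. monom (franel_coeff n k) k)"

definition franel_mean :: "nat \<Rightarrow> real" where
  "franel_mean n = poly (pderiv (franel_poly n)) 1 / poly (franel_poly n) 1"

definition franel_var :: "nat \<Rightarrow> real" where
  "franel_var n = poly (pderiv (pderiv (franel_poly n))) 1 / poly (franel_poly n) 1
     + franel_mean n - (franel_mean n)\<^sup>2"

lemma norm_coeff_nonneg:
  assumes "\<And>k. k \<le> n \<Longrightarrow> 0 \<le> a n k"
  shows "0 \<le> norm_coeff a n k"
  using assms by (auto simp: norm_coeff_def intro!: divide_nonneg_nonneg sum_nonneg)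

lemma norm_coeff_le_1:
  assumes "\<And>k. k \<le> n \<Longrightarrow> 0 \<le> a n k"
  shows "norm_coeff a n k \<le> 1"
proof (cases "0 \<le> k \<and> k \<le> int n")
  case True
  then have "nat k \<in> {0..n}" by auto
  then have "a n (nat k) \<le> (\<Sum>j=0..n. a n j)"
    using assms by (intro member_le_sum) auto
  moreover have "0 \<le> (\<Sum>j=0..n. a n j)" using assms by (intro sum_nonneg) auto
  ultimately show ?thesis
    using True by (auto simp: norm_coeff_def divide_le_eq_1)
qed (auto simp: norm_coeff_def)

lemma bdd_above_llt_error:
  assumes "\<And>k. k \<le> n \<Longrightarrow> 0 \<le> a n k"
  shows "bdd_above (range (llt_error a \<mu> v n))"
proof (rule bdd_aboveI2)
  fix x :: real
  define p where "p = norm_coeff a n \<lfloor>\<mu> n + x * sqrt (v n)\<rfloor>"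
  have "\<bar>p\<bar> \<le> 1"
    using norm_coeff_nonneg[where n = n and a = a, OF assms] norm_coeff_le_1[where n = n and a = a, OF assms] by (simp add: p_def)
  then have "\<bar>sqrt (v n) * p\<bar> \<le> \<bar>sqrt (v n)\<bar>"
    by (simp add: abs_mult mult_left_le)
  moreover have "\<bar>1 / sqrt (2 * pi) * exp (- x\<^sup>2 / 2)\<bar> \<le> 1 / sqrt (2 * pi)"
    by (auto simp: abs_mult divide_right_mono)
  ultimately show "llt_error a \<mu> v n x \<le> \<bar>sqrt (v n)\<bar> + 1 / sqrt (2 * pi)"
    unfolding llt_error_def p_def[symmetric] by linarith
qed

lemma bdd_above_clt_error:
  assumes "\<And>k. k \<le> n \<Longrightarrow> 0 \<le> a n k"
  shows "bdd_above (range (clt_error a \<mu> v n))"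
proof (rule bdd_aboveI2)
  fix x :: real
  let ?e = "\<lambda>t::real. exp (- t\<^sup>2 / 2)"
  have "integrable lborel (\<lambda>t. sqrt (2 * pi) * std_normal_density t)" by simp
  then have int: "integrable lborel ?e" by (simp add: std_normal_density_def)
  have "(LINT t:{..x}|lborel. ?e t) \<le> (LINT t|lborel. ?e t)"
    unfolding set_lebesgue_integral_def
    using int by (intro integral_mono integrable_mult_indicator)
      (auto simp: indicator_def integrable_mult_indicator)
  moreover have "0 \<le> (LINT t:{..x}|lborel. ?e t)"
    unfolding set_lebesgue_integral_def by (intro Bochner_Integration.integral_nonneg) auto
  ultimately have I: "\<bar>1 / sqrt (2 * pi) * (LINT t:{..x}|lborel. ?e t)\<bar>
      \<le> 1 / sqrt (2 * pi) * (LINT t|lborel. ?e t)"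
    by (simp add: divide_right_mono)
  let ?S = "\<Sum>k | k \<in> {0..int n} \<and> real_of_int k \<le> \<mu> n + x * sqrt (v n). norm_coeff a n k"
  have "?S \<le> (\<Sum>k\<in>{0..int n}. norm_coeff a n k)"
    by (intro sum_mono2) (auto intro: norm_coeff_nonneg[where n = n and a = a, OF assms])
  moreover have "0 \<le> ?S" by (intro sum_nonneg norm_coeff_nonneg[where n = n and a = a, OF assms])
  ultimately show "clt_error a \<mu> v n x
      \<le> (\<Sum>k\<in>{0..int n}. norm_coeff a n k) + 1 / sqrt (2 * pi) * (LINT t|lborel. ?e t)"
    using I unfolding clt_error_def by linarith
qed

end

theory Submission
  imports Defs
begin

text \<open>By symmetry the mean is \<open>n/2\<close>. Let \<open>r\<^sub>n(k)\<close> be the cube of the ratio of \<open>n choose k\<close> to the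
  central binomial coefficient. Comparing consecutive binomial coefficients gives
  \<open>r\<^sub>n(k) = exp (- 6 (k - n/2)\<^sup>2 / (n + 1)) + O(1/n)\<close> uniformly in \<open>k\<close>, together with a Gaussian
  majorant. Rescaled by \<open>sqrt (n + 1)\<close>, the even central moments of \<open>r\<^sub>n\<close> are integrals of step
  functions, and dominated convergence sends them to those of \<open>exp (- 6 y\<^sup>2)\<close>; this gives the
  normalising constant and the variance, hence the local limit theorem. The central limit theorem
  follows from the local one by Scheffe's lemma.\<close>

section \<open>Gaussian bounds for binomial coefficients\<close>

text \<open>With \<open>t = k - n/2\<close>, the ratio of consecutive binomial coefficients is \<open>(1 - x) / (1 + x)\<close>
  for \<open>x = (2 t + 1) / (n + 1)\<close>. The bounds \<open>x \<le> artanh x \<le> x + x\<^sup>3\<close> on its logarithm \<open>- 2 artanh x\<close>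
  telescope, because \<open>(t + 1)\<^sup>2 - t\<^sup>2 = 2 t + 1\<close>.\<close>

lemma one_minus_le_one_plus_exp:
  fixes x :: real
  assumes "0 \<le> x"
  shows "1 - x \<le> (1 + x) * exp (- (2 * x))"
proof -
  \<comment> \<open>The inequality is multiplied by \<open>exp x\<close> to make it symmetric under
    \<open>x \<mapsto> - x\<close>; the derivative then collapses to
    \<open>t * (exp t - exp (- t))\<close>.\<close>
  define g where "g = (\<lambda>x::real. (1 + x) * exp (- x) - (1 - x) * exp x)"
  have "g 0 \<le> g x"
  proof (rule DERIV_nonneg_imp_nondecreasing[OF assms])
    fix t :: real assume t: "0 \<le> t" "t \<le> x"
    have "(g has_real_derivative t * (exp t - exp (- t))) (at t)"
      unfolding g_def by (auto intro!: derivative_eq_intros simp: algebra_simps)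
    moreover have "0 \<le> t * (exp t - exp (- t))"
      using t by (intro mult_nonneg_nonneg) auto
    ultimately show "\<exists>y. (g has_real_derivative y) (at t) \<and> 0 \<le> y" by blast
  qed
  then have "(1 - x) * exp x \<le> (1 + x) * exp (- x)" by (simp add: g_def)
  then have "(1 - x) * exp x * exp (- x) \<le> (1 + x) * exp (- x) * exp (- x)"
    by (intro mult_right_mono) auto
  then show ?thesis by (simp add: mult.assoc flip: exp_add)
qed

lemma one_minus_ge_one_plus_exp:
  fixes x :: real
  assumes "0 \<le> x" "x \<le> 1 / 2"
  shows "(1 + x) * exp (- (2 * x) - 2 * x ^ 3) \<le> 1 - x"
proof -
  define g where "g = (\<lambda>x::real. ln (1 - x) - ln (1 + x) + 2 * x + 2 * x ^ 3)"
  have "g 0 \<le> g x"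
  proof (rule DERIV_nonneg_imp_nondecreasing[OF assms(1)])
    fix t :: real assume t: "0 \<le> t" "t \<le> x"
    then have t': "t \<le> 1 / 2" using assms by simp
    have sq: "t\<^sup>2 \<le> 1 / 4"
      using power_mono[OF t' t(1), of 2] by (simp add: power2_eq_square)
    have "(g has_real_derivative - 1 / (1 - t) - 1 / (1 + t) + 2 + 6 * t\<^sup>2) (at t)"
      unfolding g_def using t t' by (auto intro!: derivative_eq_intros simp: divide_simps)
    \<comment> \<open>The assumption \<open>x \<le> 1 / 2\<close> enters through the factor
      \<open>2 - 3 * t\<^sup>2\<close>, which is at least 5/4.\<close>
    moreover have "- 1 / (1 - t) - 1 / (1 + t) + 2 + 6 * t\<^sup>2
        = 2 * t\<^sup>2 * (2 - 3 * t\<^sup>2) / ((1 - t) * (1 + t))"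
      using t t' by (simp add: divide_simps) (simp add: algebra_simps power2_eq_square)
    moreover have "0 \<le> 2 * t\<^sup>2 * (2 - 3 * t\<^sup>2) / ((1 - t) * (1 + t))"
      using t t' sq by (intro divide_nonneg_nonneg mult_nonneg_nonneg) auto
    ultimately show "\<exists>y. (g has_real_derivative y) (at t) \<and> 0 \<le> y" by metis
  qed
  then have "ln (1 + x) + (- (2 * x) - 2 * x ^ 3) \<le> ln (1 - x)" by (simp add: g_def)
  then have "exp (ln (1 + x) + (- (2 * x) - 2 * x ^ 3)) \<le> exp (ln (1 - x))" by simp
  then show ?thesis using assms by (simp add: exp_add)
qed

lemma binomial_Suc_ratio:
  assumes "k < n"
  defines "x \<equiv> (2 * (real k - real n / 2) + 1) / (real n + 1)"
  shows "real (n choose Suc k) * (1 + x) = real (n choose k) * (1 - x)"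
proof -
  have "Suc k * (n choose Suc k) = (n - k) * (n choose k)"
    using assms by (metis Suc_times_binomial_eq binomial_absorb_comp binomial_absorption mult.commute)
  then have "real (Suc k * (n choose Suc k)) = real ((n - k) * (n choose k))" by simp
  then have *: "(1 + real k) * real (n choose Suc k) = (real n - real k) * real (n choose k)"
    using assms(1) by (simp only: of_nat_mult of_nat_diff[OF less_imp_le] of_nat_Suc)
  have x: "1 + x = 2 / (real n + 1) * (1 + real k)" "1 - x = 2 / (real n + 1) * (real n - real k)"
    unfolding x_def by (auto simp: field_simps)
  have "real (n choose Suc k) * (1 + x) = 2 / (real n + 1) * ((1 + real k) * real (n choose Suc k))"
    unfolding x by (simp only: mult_ac)
  also have "\<dots> = real (n choose k) * (1 - x)"
    unfolding * x by (simp only: mult_ac)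
  finally show ?thesis .
qed

text \<open>Induction upward from the mirror image of the middle index. Each step contributes a
  factor at most \<open>exp (- (2 * x))\<close>, and \<open>2 * x\<close> is exactly the increment
  of \<open>2 * t\<^sup>2 / (n + 1)\<close>. The summand 1/2 pays for the start: there t is 0 for
  even n and 1/2 for odd n.\<close>

lemma binomial_le_middle_exp_upper_half:
  assumes "n - n div 2 \<le> k" "k \<le> n"
  shows "real (n choose k)
    \<le> real (n choose (n div 2)) * exp ((1 / 2 - 2 * (real k - real n / 2)\<^sup>2) / (real n + 1))"
  using assms
proof (induction k rule: dec_induct)
  case base
  have "\<bar>real (n - n div 2) - real n / 2\<bar> \<le> 1 / 2" by linarith
  then have "(real (n - n div 2) - real n / 2)\<^sup>2 \<le> (1 / 2)\<^sup>2" by (rule power2_le_iff_abs_le[THEN iffD2, rotated]) simp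
  then have "(real (n - n div 2) - real n / 2)\<^sup>2 \<le> 1 / 4" by (simp only: power2_eq_square)
  then have "1 \<le> exp ((1 / 2 - 2 * (real (n - n div 2) - real n / 2)\<^sup>2) / (real n + 1))"
    by simp
  moreover have "n choose (n - n div 2) = n choose (n div 2)"
    by (intro binomial_symmetric[symmetric]) simp
  ultimately show ?case by (simp add: mult_le_cancel_left1)
next
  case (step k)
  define x where "x = (2 * (real k - real n / 2) + 1) / (real n + 1)"
  have "real n / 2 \<le> real k" using step by linarith
  then have x: "0 \<le> x" unfolding x_def by simp
  have e: "(1 / 2 - 2 * (real (Suc k) - real n / 2)\<^sup>2) / (real n + 1)
    = (1 / 2 - 2 * (real k - real n / 2)\<^sup>2) / (real n + 1) + - (2 * x)"
    unfolding x_def by (simp add: divide_simps) (simp add: algebra_simps power2_eq_square)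
  have "real (n choose Suc k) * (1 + x) = real (n choose k) * (1 - x)"
    using binomial_Suc_ratio[of k n] step by (simp add: x_def)
  also have "\<dots> \<le> real (n choose k) * ((1 + x) * exp (- (2 * x)))"
    using one_minus_le_one_plus_exp[OF x] by (intro mult_left_mono) auto
  finally have "(1 + x) * real (n choose Suc k) \<le> (1 + x) * (real (n choose k) * exp (- (2 * x)))"
    by (simp add: mult_ac)
  then have "real (n choose Suc k) \<le> real (n choose k) * exp (- (2 * x))"
    using x by simp
  also have "\<dots> \<le> real (n choose (n div 2))
      * exp ((1 / 2 - 2 * (real k - real n / 2)\<^sup>2) / (real n + 1)) * exp (- (2 * x))"
    using step by (intro mult_right_mono) auto
  finally show ?case unfolding e exp_add by (simp add: mult_ac)
qed

text \<open>The reflection \<open>k \<mapsto> n - k\<close> preserves both the binomial coefficient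
  and the distance to \<open>n / 2\<close>, so bounds in these two quantities need a proof on the
  upper half only.\<close>

lemma binomial_reflect_cases:
  assumes "k \<le> n"
    and "\<And>k. n - n div 2 \<le> k \<Longrightarrow> k \<le> n \<Longrightarrow> P (n choose k) \<bar>real k - real n / 2\<bar>"
  shows "P (n choose k) \<bar>real k - real n / 2\<bar>"
proof (cases "n - n div 2 \<le> k")
  case False
  then have "n choose k = n choose (n - k)" "\<bar>real k - real n / 2\<bar> = \<bar>real (n - k) - real n / 2\<bar>"
    using assms(1) binomial_symmetric[of k n] by (auto simp: of_nat_diff)
  then show ?thesis using assms(2)[of "n - k"] False by simp
qed (use assms in auto)

lemma binomial_le_middle_exp:
  assumes "k \<le> n"
  shows "real (n choose k)
    \<le> real (n choose (n div 2)) * exp ((1 / 2 - 2 * (real k - real n / 2)\<^sup>2) / (real n + 1))"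
  using binomial_reflect_cases[OF assms, where P = "\<lambda>b t. real b
    \<le> real (n choose (n div 2)) * exp ((1 / 2 - 2 * t\<^sup>2) / (real n + 1))"]
    binomial_le_middle_exp_upper_half by simp

text \<open>The same induction with the lower bound on the ratio. The range condition keeps
  \<open>x \<le> 1 / 2\<close>, and the quartic term collects the losses \<open>2 * x ^ 3\<close>,
  because \<open>2 * (2 * t + 1) ^ 3\<close> is at most
  \<open>4 * ((t + 1) ^ 4 - t ^ 4)\<close>.\<close>

lemma binomial_ge_middle_exp_upper_half:
  assumes "n - n div 2 \<le> k" "k \<le> n" "4 * (real k - real n / 2) \<le> real n + 1"
  shows "real (n choose (n div 2)) \<le> real (n choose k)
    * exp (2 * (real k - real n / 2)\<^sup>2 / (real n + 1) + 4 * (real k - real n / 2) ^ 4 / (real n + 1) ^ 3)"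
  using assms
proof (induction k rule: dec_induct)
  case base
  have "n choose (n - n div 2) = n choose (n div 2)"
    by (intro binomial_symmetric[symmetric]) simp
  then show ?case by (simp add: mult_le_cancel_left1)
next
  case (step k)
  define t where "t = real k - real n / 2"
  define N where "N = real n + 1"
  have N: "N > 0" by (simp add: N_def)
  define x where "x = (2 * t + 1) / N"
  have t: "0 \<le> t" "4 * (t + 1) \<le> N" using step by (auto simp: t_def N_def)
  have x: "0 \<le> x" "x \<le> 1 / 2" unfolding x_def using t N by (auto simp: divide_simps)
  have "2 * (x * N) ^ 3 \<le> 4 * ((t + 1) ^ 4 - t ^ 4)"
    unfolding x_def using t N by (simp add: field_simps eval_nat_numeral)
  then have "2 * x ^ 3 \<le> 4 * ((t + 1) ^ 4 - t ^ 4) / N ^ 3"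
    using N by (simp add: field_simps power_mult_distrib)
  then have "4 * t ^ 4 / N ^ 3 + 2 * x ^ 3 \<le> 4 * (t + 1) ^ 4 / N ^ 3"
    by (simp add: field_simps diff_divide_distrib)
  moreover have "2 * t\<^sup>2 / N + 2 * x = 2 * (t + 1)\<^sup>2 / N"
    unfolding x_def using N by (simp add: field_simps power2_eq_square)
  ultimately have e: "2 * t\<^sup>2 / N + 4 * t ^ 4 / N ^ 3 \<le>
    - (2 * x) - 2 * x ^ 3 + (2 * (t + 1)\<^sup>2 / N + 4 * (t + 1) ^ 4 / N ^ 3)"
    by simp
  have "(1 + x) * (real (n choose k) * exp (- (2 * x) - 2 * x ^ 3)) \<le> real (n choose k) * (1 - x)"
    using mult_left_mono[OF one_minus_ge_one_plus_exp[OF x], of "real (n choose k)"] by (simp add: mult_ac)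
  also have "\<dots> = (1 + x) * real (n choose Suc k)"
    using binomial_Suc_ratio[of k n] step unfolding x_def t_def N_def by (simp only: Suc_le_eq mult.commute)
  finally have r: "real (n choose k) * exp (- (2 * x) - 2 * x ^ 3) \<le> real (n choose Suc k)"
    using x by simp
  have "real (n choose (n div 2)) \<le> real (n choose k) * exp (2 * t\<^sup>2 / N + 4 * t ^ 4 / N ^ 3)"
    using step t unfolding t_def N_def by simp
  also have "\<dots> \<le> real (n choose k) * exp (- (2 * x) - 2 * x ^ 3)
      * exp (2 * (t + 1)\<^sup>2 / N + 4 * (t + 1) ^ 4 / N ^ 3)"
    using e unfolding mult.assoc exp_add[symmetric] by (intro mult_left_mono) auto
  also have "\<dots> \<le> real (n choose Suc k) * exp (2 * (t + 1)\<^sup>2 / N + 4 * (t + 1) ^ 4 / N ^ 3)"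
    using r by (intro mult_right_mono) auto
  finally show ?case by (simp add: t_def N_def algebra_simps)
qed

lemma binomial_ge_middle_exp:
  assumes "k \<le> n" "4 * \<bar>real k - real n / 2\<bar> \<le> real n + 1"
  shows "real (n choose (n div 2)) \<le> real (n choose k)
    * exp (2 * (real k - real n / 2)\<^sup>2 / (real n + 1) + 4 * (real k - real n / 2) ^ 4 / (real n + 1) ^ 3)"
proof -
  have "4 * \<bar>real k - real n / 2\<bar> \<le> real n + 1 \<longrightarrow> real (n choose (n div 2)) \<le> real (n choose k)
    * exp (2 * \<bar>real k - real n / 2\<bar>\<^sup>2 / (real n + 1) + 4 * \<bar>real k - real n / 2\<bar> ^ 4 / (real n + 1) ^ 3)"
    by (rule binomial_reflect_cases[OF assms(1)])
       (use binomial_ge_middle_exp_upper_half in auto)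
  then show ?thesis using assms(2) by (simp add: power_even_abs)
qed

section \<open>From local to central limit theorems\<close>

text \<open>Turns lattice sums into integrals: every integer k owns a half-open interval of length
  \<open>1 / s\<close> on which the floor equals k.\<close>

lemma has_bochner_integral_floor_step:
  fixes F :: "int \<Rightarrow> real" and m s :: real
  assumes s: "0 < s" and A: "finite A" "\<And>k. k \<notin> A \<Longrightarrow> F k = 0"
  shows "has_bochner_integral lborel (\<lambda>x. F \<lfloor>m + x * s\<rfloor>) ((\<Sum>k\<in>A. F k) / s)"
proof -
  let ?I = "\<lambda>k::int. {(k - m) / s..<(k + 1 - m) / s}"
  have "x \<in> ?I k \<longleftrightarrow> \<lfloor>m + x * s\<rfloor> = k" for x k
    using s by (auto simp: floor_eq_iff field_simps)
  then have eq: "indicator (?I k) x = (if k = \<lfloor>m + x * s\<rfloor> then 1 else 0 :: real)" for x k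
    by (auto simp: indicator_def)
  have "F \<lfloor>m + x * s\<rfloor> = (\<Sum>k\<in>A. F k * indicator (?I k) x)" for x
    unfolding eq using A by (cases "\<lfloor>m + x * s\<rfloor> \<in> A") (auto simp: if_distrib sum.delta cong: if_cong)
  moreover have "has_bochner_integral lborel (\<lambda>x. \<Sum>k\<in>A. F k * indicator (?I k) x) (\<Sum>k\<in>A. F k * (1 / s))"
  proof (intro has_bochner_integral_sum has_bochner_integral_mult_right)
    fix k :: int
    have "(k - m) / s \<le> (k + 1 - m) / s" using s by (simp add: divide_right_mono)
    then have "emeasure lborel (?I k) < \<infinity>" "measure lborel (?I k) = 1 / s"
      by (auto simp: diff_divide_distrib[symmetric])
    then show "has_bochner_integral lborel (indicator (?I k)) (1 / s)"
      by (metis atLeastLessThan_borel has_bochner_integral_real_indicator sets_lborel)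
  qed
  ultimately show ?thesis by (simp add: sum_divide_distrib)
qed

lemma sum_norm_coeff_le_1: "(\<Sum>k\<in>{0..int n}. norm_coeff a n k) \<le> 1"
proof -
  have "(\<Sum>k\<in>{0..int n}. norm_coeff a n k) = (\<Sum>j=0..n. norm_coeff a n (int j))"
    by (rule sum.reindex_bij_witness[of _ int nat]) auto
  also have "\<dots> = (\<Sum>j=0..n. a n j) / (\<Sum>j=0..n. a n j)"
    by (simp add: norm_coeff_def flip: sum_divide_distrib)
  \<comment> \<open>A vanishing row sum makes the quotient 0 by convention, so only an inequality
    holds in general.\<close>
  also have "\<dots> \<le> 1" by (simp add: divide_self_if)
  finally show ?thesis .
qed

text \<open>A real supremum is informative only over a bounded set; the eventual uniform bound
  \<open>B n\<close> provides the boundedness as well as the limit.\<close>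

lemma SUP_tendsto_0:
  fixes f :: "nat \<Rightarrow> real \<Rightarrow> real"
  assumes "\<And>n x. 0 \<le> f n x" and "\<forall>\<^sub>F n in sequentially. \<forall>x. f n x \<le> B n" and "B \<longlonglongrightarrow> 0"
  shows "(\<lambda>n. SUP x. f n x) \<longlonglongrightarrow> 0"
proof (rule tendsto_sandwich[OF _ _ tendsto_const assms(3)])
  show "\<forall>\<^sub>F n in sequentially. (SUP x. f n x) \<le> B n"
    using assms(2) by eventually_elim (auto intro: cSUP_least)
  show "\<forall>\<^sub>F n in sequentially. 0 \<le> (SUP x. f n x)"
    using assms(2)
  proof eventually_elim
    case (elim n)
    then have "bdd_above (range (f n))" by auto
    then show ?case using assms(1) by (meson UNIV_I cSUP_upper2)
  qed
qed

text \<open>The step function \<open>x \<mapsto> \<sigma>\<^sub>n p(n, \<lfloor>\<mu>\<^sub>n + x \<sigma>\<^sub>n\<rfloor>)\<close> is a subprobability density, so its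
  pointwise convergence to the normal density is convergence in \<open>L\<^sup>1\<close> by Scheffe's lemma.\<close>

lemma asymp_normal_clt_if_llt:
  assumes nonneg: "\<And>n k. k \<le> n \<Longrightarrow> 0 \<le> a n k"
    and v: "\<And>n. 0 \<le> v n" "filterlim v at_top sequentially"
    and llt: "asymp_normal_llt a \<mu> v"
  shows "asymp_normal_clt a \<mu> v"
proof -
  define p where "p = norm_coeff a"
  define s where "s = (\<lambda>n. sqrt (v n))"
  define q where "q = (\<lambda>n x. s n * p n \<lfloor>\<mu> n + x * s n\<rfloor>)"
  define L where "L = (\<lambda>n. SUP x. llt_error a \<mu> v n x)"
  define D where "D = (\<lambda>n. LINT x|lborel. \<bar>q n x - std_normal_density x\<bar>)"
  have p0: "p n k = 0" if "k \<notin> {0..int n}" for n k using that by (auto simp: p_def norm_coeff_def)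
  have p_nonneg: "0 \<le> p n k" for n k
    unfolding p_def using nonneg by (rule norm_coeff_nonneg)
  have s_nonneg: "0 \<le> s n" for n using v by (simp add: s_def)
  have s_top: "filterlim s at_top sequentially"
    unfolding s_def using v(2) sqrt_at_top filterlim_compose by blast
  have L: "L \<longlonglongrightarrow> 0" using llt by (simp add: asymp_normal_llt_def L_def)
  have qL: "\<bar>q n x - std_normal_density x\<bar> \<le> L n" for n x
  proof -
    have "llt_error a \<mu> v n x \<le> L n"
      unfolding L_def by (rule cSUP_upper) (auto intro: bdd_above_llt_error nonneg)
    then show ?thesis by (simp add: llt_error_def q_def p_def s_def std_normal_density_def)
  qed
  have q_int: "has_bochner_integral lborel (q n) (\<Sum>k\<in>{0..int n}. p n k)" if "0 < s n" for n
    using has_bochner_integral_mult_right[OF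
        has_bochner_integral_floor_step[OF that, of "{0..int n}" "p n" "\<mu> n"], of "s n"] p0 that
    unfolding q_def by simp
  have q_integrable: "integrable lborel (q n)" for n
  proof (cases "s n = 0")
    case False
    then have "0 < s n" using s_nonneg[of n] by simp
    then show ?thesis by (rule integrable.intros[OF q_int])
  qed (simp add: q_def)
  have q_meas [measurable]: "q n \<in> borel_measurable lborel" for n
    using q_integrable by (rule borel_measurable_integrable)
  have q_nonneg: "0 \<le> q n x" for n x using s_nonneg p_nonneg by (simp add: q_def)
  have q_le: "(LINT x|lborel. q n x) \<le> 1" for n
  proof (cases "s n = 0")
    case False
    then have "0 < s n" using s_nonneg[of n] by simp
    then show ?thesis
      using sum_norm_coeff_le_1 by (simp add: has_bochner_integral_integral_eq[OF q_int] p_def)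
  qed (simp add: q_def)
  have lim: "(\<lambda>n. q n x) \<longlonglongrightarrow> std_normal_density x" for x
    by (rule LIM_zero_cancel, rule Lim_null_comparison[OF _ L]) (use qL in auto)
  have "(\<lambda>n. \<integral>\<^sup>+ x. norm (q n x - std_normal_density x) \<partial>lborel) \<longlonglongrightarrow> 0"
  proof (rule Scheffe_lemma2)
    fix n
    have "(\<integral>\<^sup>+ x. norm (q n x) \<partial>lborel) = ennreal (LINT x|lborel. q n x)"
      using q_nonneg q_integrable by (simp add: nn_integral_eq_integral)
    \<comment> \<open>Scheffe's lemma asks only that the mass of \<open>q n\<close> not exceed that
      of the limit, which is 1.\<close>
    also have "\<dots> \<le> ennreal (LINT x|lborel. std_normal_density x)"
      using q_le[of n] by (intro ennreal_leI) simp
    also have "\<dots> = (\<integral>\<^sup>+ x. norm (std_normal_density x) \<partial>lborel)"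
      by (subst nn_integral_eq_integral) auto
    finally show "(\<integral>\<^sup>+ x. norm (q n x) \<partial>lborel) \<le> (\<integral>\<^sup>+ x. norm (std_normal_density x) \<partial>lborel)" .
  qed (use lim in auto)
  moreover have "(\<integral>\<^sup>+ x. norm (q n x - std_normal_density x) \<partial>lborel) = ennreal (D n)" for n
    unfolding D_def using q_integrable by (subst nn_integral_eq_integral[symmetric]) auto
  moreover have D_nonneg: "0 \<le> D n" for n unfolding D_def by simp
  ultimately have D: "D \<longlonglongrightarrow> 0" using ennreal_tendsto_0_iff by simp
  \<comment> \<open>Both terms of the error become integrals over the line. They differ by at most
    the L1 distance \<open>D n\<close> plus the mass of the one cell that x may cut in two, and this
    mass is \<open>q n x / s n\<close>.\<close>
  have bound: "clt_error a \<mu> v n x \<le> D n + (L n + 1) / s n" if s: "0 < s n" for n x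
  proof -
    define k0 where "k0 = \<lfloor>\<mu> n + x * s n\<rfloor>"
    define F where "F = (\<lambda>k. if k \<le> k0 then p n k else 0)"
    define G where "G = (\<lambda>k. if k = k0 then p n k else 0)"
    let ?fl = "\<lambda>y. \<lfloor>\<mu> n + y * s n\<rfloor>"
    let ?\<phi> = "\<lambda>y. indicator {..x} y * std_normal_density y"
    have F: "has_bochner_integral lborel (\<lambda>y. s n * F (?fl y)) (\<Sum>k\<in>{0..int n}. F k)"
      using has_bochner_integral_mult_right[OF
          has_bochner_integral_floor_step[OF s, of "{0..int n}" F "\<mu> n"], of "s n"] p0 s
      by (simp add: F_def)
    have G: "has_bochner_integral lborel (\<lambda>y. s n * G (?fl y)) (p n k0)"
      using has_bochner_integral_mult_right[OF
          has_bochner_integral_floor_step[OF s, of "{k0}" G "\<mu> n"], of "s n"] s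
      by (simp add: G_def)
    have \<phi>: "integrable lborel ?\<phi>"
      using integrable_mult_indicator[of "{..x}" lborel std_normal_density] by simp
    \<comment> \<open>Left of x the floor is at most \<open>k0\<close>, so F agrees with p. Right of
      x it is at least \<open>k0\<close>, and F survives only in the rest of the cell of
      \<open>k0\<close>, which G covers.\<close>
    have pt: "\<bar>s n * F (?fl y) - ?\<phi> y\<bar> \<le> \<bar>q n y - std_normal_density y\<bar> + s n * G (?fl y)" for y
    proof (cases "y \<le> x")
      case True
      then have "?fl y \<le> k0" unfolding k0_def using s by (intro floor_mono) simp
      moreover have "0 \<le> s n * G (?fl y)" using s p_nonneg by (simp add: G_def)
      ultimately show ?thesis using True by (simp add: F_def q_def)
    next
      case False
      then have "k0 \<le> ?fl y" unfolding k0_def using s by (intro floor_mono) simp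
      then have "F (?fl y) = G (?fl y)" by (simp add: F_def G_def)
      moreover have "0 \<le> s n * G (?fl y)" using s p_nonneg by (simp add: G_def)
      ultimately show ?thesis using False by simp
    qed
    have "{k. k \<in> {0..int n} \<and> real_of_int k \<le> \<mu> n + x * sqrt (v n)} = {k\<in>{0..int n}. k \<le> k0}"
      by (auto simp: k0_def s_def le_floor_iff)
    then have "(\<Sum>k | k \<in> {0..int n} \<and> real_of_int k \<le> \<mu> n + x * sqrt (v n). norm_coeff a n k)
        = (\<Sum>k\<in>{0..int n}. F k)"
      by (simp only: F_def p_def sum.inter_filter finite_atLeastAtMost_int)
    also have "\<dots> = (LINT y|lborel. s n * F (?fl y))"
      by (rule has_bochner_integral_integral_eq[OF F, symmetric])
    finally have "clt_error a \<mu> v n x = \<bar>(LINT y|lborel. s n * F (?fl y)) - (LINT y|lborel. ?\<phi> y)\<bar>"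
      unfolding clt_error_def set_lebesgue_integral_def std_normal_density_def by (simp add: mult_ac)
    also have "\<dots> = \<bar>LINT y|lborel. s n * F (?fl y) - ?\<phi> y\<bar>"
      by (subst Bochner_Integration.integral_diff[OF integrable.intros[OF F] \<phi>]) (rule refl)
    also have "\<dots> \<le> (LINT y|lborel. \<bar>s n * F (?fl y) - ?\<phi> y\<bar>)"
      by (rule integral_abs_bound)
    also have "\<dots> \<le> (LINT y|lborel. \<bar>q n y - std_normal_density y\<bar> + s n * G (?fl y))"
      by (intro integral_mono Bochner_Integration.integrable_add integrable_abs
          Bochner_Integration.integrable_diff integrable.intros[OF F] integrable.intros[OF G]
          \<phi> q_integrable pt integrable_normal_density zero_less_one)
    also have "\<dots> = D n + p n k0"
      unfolding D_def has_bochner_integral_integral_eq[OF G, symmetric]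
      by (intro Bochner_Integration.integral_add integrable_abs Bochner_Integration.integrable_diff
          integrable.intros[OF G] q_integrable integrable_normal_density zero_less_one)
    also have "p n k0 = q n x / s n" using s by (simp add: q_def k0_def)
    also have "q n x \<le> L n + 1"
    proof -
      have "1 / sqrt (2 * pi) \<le> 1" using pi_ge_two by simp
      moreover have "exp (- x\<^sup>2 / 2) \<le> 1" by simp
      ultimately have "std_normal_density x \<le> 1"
        unfolding std_normal_density_def by (intro mult_le_one) auto
      then show ?thesis using qL[of n x] by linarith
    qed
    finally show ?thesis using s by (simp add: divide_right_mono)
  qed
  show ?thesis unfolding asymp_normal_clt_def
  proof (rule SUP_tendsto_0)
    have "\<forall>\<^sub>F n in sequentially. 0 < s n"
      using s_top by (simp add: filterlim_at_top_dense)
    then show "\<forall>\<^sub>F n in sequentially. \<forall>x. clt_error a \<mu> v n x \<le> D n + (L n + 1) / s n"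
      by eventually_elim (use bound in auto)
    have "(\<lambda>n. (L n + 1) / s n) \<longlonglongrightarrow> 0"
      by (rule tendsto_divide_0[OF tendsto_add[OF L tendsto_const]])
         (rule filterlim_at_top_imp_at_infinity[OF s_top])
    from tendsto_add[OF D this] show "(\<lambda>n. D n + (L n + 1) / s n) \<longlonglongrightarrow> 0" by simp
  qed (simp add: clt_error_def)
qed

section \<open>Franel numbers\<close>

text \<open>The integer index and the value 0 outside the row follow \<open>norm_coeff\<close>, so
  that floors of arbitrary reals can be inserted.\<close>

definition franel_ratio :: "nat \<Rightarrow> int \<Rightarrow> real" where
  "franel_ratio n k = (if 0 \<le> k \<and> k \<le> int n
     then (real (n choose nat k) / real (n choose (n div 2))) ^ 3 else 0)"

lemma franel_ratio_nonneg: "0 \<le> franel_ratio n k"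
  by (simp add: franel_ratio_def)

lemma franel_ratio_le:
  "franel_ratio n k \<le> exp (3 / (2 * (real n + 1))) * exp (- 6 * (real_of_int k - real n / 2)\<^sup>2 / (real n + 1))"
proof (cases "0 \<le> k \<and> k \<le> int n")
  case True
  let ?e = "(1 / 2 - 2 * (real (nat k) - real n / 2)\<^sup>2) / (real n + 1)"
  have c: "0 < real (n choose (n div 2))" by (simp add: zero_less_binomial)
  have "real (n choose nat k) / real (n choose (n div 2)) \<le> exp ?e"
    using binomial_le_middle_exp[of "nat k" n] True c by (simp add: divide_le_eq mult.commute nat_le_iff)
  then have "(real (n choose nat k) / real (n choose (n div 2))) ^ 3 \<le> exp ?e ^ 3"
    by (intro power_mono) auto
  also have "\<dots> = exp (3 * ?e)" by (simp flip: exp_of_nat_mult)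
  also have "3 * ?e = 3 / (2 * (real n + 1)) + - 6 * (real_of_int k - real n / 2)\<^sup>2 / (real n + 1)"
    using True by (simp add: divide_simps) (simp add: algebra_simps)
  finally show ?thesis using True by (simp only: exp_add franel_ratio_def if_True simp_thms)
qed (simp only: franel_ratio_def if_False, simp)

text \<open>Near the centre, with \<open>w = t\<^sup>2 / N\<close>, the quartic loss is a factor
  \<open>exp (- (12 / N * w\<^sup>2))\<close>, and \<open>w\<^sup>2 * exp (- (6 * w))\<close> is at
  most 1. Away from it the Gaussian alone is below \<open>12 / N\<close>. Hence the additive error
  is uniform over all integers k.\<close>

lemma franel_ratio_ge:
  "exp (- 6 * (real_of_int k - real n / 2)\<^sup>2 / (real n + 1)) - 12 / (real n + 1) \<le> franel_ratio n k"
proof -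
  define N where "N = real n + 1"
  define t where "t = real_of_int k - real n / 2"
  have N: "1 \<le> N" by (simp add: N_def)
  have "exp (- 6 * t\<^sup>2 / N) - 12 / N \<le> franel_ratio n k"
  proof (cases "4 * \<bar>t\<bar> \<le> N")
    case True
    then have "\<bar>real_of_int k - real n / 2\<bar> \<le> (real n + 1) / 4" unfolding t_def N_def by simp
    \<comment> \<open>The distance bound gives only strict inequalities against -1 and
      \<open>n + 1\<close>; integrality of k then places it inside the row.\<close>
    then have "- 1 < real_of_int k" and "real_of_int k < real n + 1"
      unfolding abs_le_iff by (simp_all add: field_simps)
    then have k: "0 \<le> k" "k \<le> int n" by simp_all
    have c: "0 < real (n choose (n div 2))" by (simp add: zero_less_binomial)
    define z where "z = 2 * t\<^sup>2 / N + 4 * t ^ 4 / N ^ 3"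
    define w where "w = t\<^sup>2 / N"
    have w: "0 \<le> w" using N by (simp add: w_def)
    have "real (n choose (n div 2)) \<le> real (n choose nat k) * exp z"
      using binomial_ge_middle_exp[of "nat k" n] True k by (simp add: t_def z_def N_def nat_le_iff)
    then have "exp (- z) \<le> real (n choose nat k) / real (n choose (n div 2))"
      using c by (simp add: exp_minus field_simps)
    then have "exp (- z) ^ 3 \<le> (real (n choose nat k) / real (n choose (n div 2))) ^ 3"
      by (intro power_mono) auto
    then have r: "exp (3 * (- z)) \<le> franel_ratio n k"
      using k by (simp add: franel_ratio_def flip: exp_of_nat_mult)
    have z: "3 * (- z) = - (6 * w) + - (12 / N * w\<^sup>2)"
      using N by (simp add: z_def w_def field_simps power2_eq_square eval_nat_numeral)
    have "1 + - (12 / N * w\<^sup>2) \<le> exp (- (12 / N * w\<^sup>2))" by (rule exp_ge_add_one_self)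
    then have "exp (- (6 * w)) * (1 + - (12 / N * w\<^sup>2)) \<le> exp (3 * (- z))"
      unfolding z exp_add by (intro mult_left_mono) auto
    moreover have "12 / N * (w\<^sup>2 * exp (- (6 * w))) \<le> 12 / N * 1"
    proof (intro mult_left_mono)
      have "w \<le> exp (3 * w)" using exp_ge_add_one_self[of "3 * w"] w by linarith
      then have "w\<^sup>2 \<le> (exp (3 * w))\<^sup>2" using w by (intro power_mono)
      also have "\<dots> = exp (6 * w)" by (simp flip: exp_of_nat_mult)
      finally show "w\<^sup>2 * exp (- (6 * w)) \<le> 1" by (simp add: exp_minus field_simps)
    qed (use N in auto)
    moreover have "- 6 * t\<^sup>2 / N = - (6 * w)" by (simp add: w_def)
    ultimately show ?thesis using r by (simp add: algebra_simps)
  next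
    case False
    have "N\<^sup>2 \<le> (4 * \<bar>t\<bar>)\<^sup>2" using False N by (intro power_mono) auto
    then have "N\<^sup>2 \<le> 16 * t\<^sup>2" by (simp add: power_mult_distrib)
    then have "N\<^sup>2 \<le> 72 * t\<^sup>2" using zero_le_power2[of t] by linarith
    then have "N / 12 \<le> 6 * t\<^sup>2 / N" using N by (simp add: field_simps power2_eq_square)
    then have "N / 12 \<le> exp (6 * t\<^sup>2 / N)" using exp_ge_add_one_self[of "6 * t\<^sup>2 / N"] by linarith
    then have "exp (- (6 * t\<^sup>2 / N)) \<le> 12 / N" using N by (simp add: exp_minus field_simps)
    then show ?thesis using franel_ratio_nonneg[of n k] by simp
  qed
  then show ?thesis by (simp add: N_def t_def)
qed

text \<open>The multiplicative excess in the upper bound becomes additive since the Gaussian is at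
  most 1.\<close>

lemma franel_ratio_gaussian:
  "\<bar>franel_ratio n k - exp (- 6 * (real_of_int k - real n / 2)\<^sup>2 / (real n + 1))\<bar>
    \<le> (exp (3 / (2 * (real n + 1))) - 1) + 12 / (real n + 1)" (is "\<bar>_ - ?E\<bar> \<le> ?d + _")
proof -
  have "?E \<le> 1" "1 \<le> exp (3 / (2 * (real n + 1)))" by (auto simp: divide_nonneg_nonneg)
  then have "?d * ?E \<le> ?d" by (intro mult_left_le) auto
  then have "franel_ratio n k - ?E \<le> ?d"
    using franel_ratio_le[of n k] by (simp add: algebra_simps)
  moreover have "0 \<le> 12 / (real n + 1)" "0 \<le> ?d" by auto
  ultimately show ?thesis using franel_ratio_ge[of k n] by linarith
qed

lemma franel_error_tendsto_0: "(\<lambda>n. (exp (3 / (2 * (real n + 1))) - 1) + 12 / (real n + 1)) \<longlonglongrightarrow> 0"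
  by real_asymp

section \<open>Convergence of the rescaled even moments\<close>

lemma gaussian_even_moment:
  "(LINT y|lborel. y ^ (2 * j) * exp (- 6 * y\<^sup>2)) = sqrt (pi / 6) * (fact (2 * j) / (24 ^ j * fact j))"
proof -
  \<comment> \<open>Up to the factor \<open>sqrt (pi / 6)\<close> the limit is the normal density of
    variance 1/12, the source of the constant in the variance.\<close>
  have "normal_density 0 (sqrt (1 / 12)) y = exp (- 6 * y\<^sup>2) / sqrt (pi / 6)" for y
    by (simp add: normal_density_def)
  then have "(LINT y|lborel. y ^ (2 * j) * exp (- 6 * y\<^sup>2))
    = (LINT y|lborel. sqrt (pi / 6) * (normal_density 0 (sqrt (1 / 12)) y * (y - 0) ^ (2 * j)))"
    by (simp add: mult_ac)
  also have "\<dots> = sqrt (pi / 6) * (fact (2 * j) / (24 ^ j * fact j))"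
    by (subst integral_mult_right_zero, subst integral_normal_moment_even) auto
  finally show ?thesis .
qed

text \<open>One term of the exponential series is at most the whole. With w a square, this lets part
  of the Gaussian decay absorb the polynomial factor of a moment.\<close>

lemma power_le_fact_exp:
  fixes w :: real
  assumes "0 \<le> w"
  shows "w ^ j \<le> fact j * exp w"
proof -
  have "(\<Sum>i\<in>{j}. w ^ i /\<^sub>R fact i) \<le> (\<Sum>i. w ^ i /\<^sub>R fact i)"
    using assms by (intro sum_le_suminf summable_exp_generic) auto
  then show ?thesis by (simp add: exp_def field_simps)
qed

lemma floor_scaled_diff:
  fixes m y s :: real
  assumes "0 < s"
  shows "\<bar>(of_int \<lfloor>m + y * s\<rfloor> - m) / s - y\<bar> \<le> 1 / s"
proof -
  have "\<bar>of_int \<lfloor>m + y * s\<rfloor> - m - y * s\<bar> \<le> 1" by linarith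
  then have "\<bar>of_int \<lfloor>m + y * s\<rfloor> - m - y * s\<bar> / s \<le> 1 / s" using assms by (simp add: divide_right_mono)
  also have "\<bar>of_int \<lfloor>m + y * s\<rfloor> - m - y * s\<bar> / s = \<bar>(of_int \<lfloor>m + y * s\<rfloor> - m) / s - y\<bar>"
    using assms by (simp add: field_simps abs_divide[symmetric])
  finally show ?thesis .
qed

lemma franel_ratio_moment_tendsto:
  "(\<lambda>n. (\<Sum>k\<in>{0..int n}. ((of_int k - real n / 2) / sqrt (real n + 1)) ^ (2 * j) * franel_ratio n k)
      / sqrt (real n + 1)) \<longlonglongrightarrow> sqrt (pi / 6) * (fact (2 * j) / (24 ^ j * fact j))"
proof -
  define s where "s = (\<lambda>n. sqrt (real n + 1))"
  have s: "1 \<le> s n" "0 < s n" "(s n)\<^sup>2 = real n + 1" for n by (auto simp: s_def)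
  define u where "u = (\<lambda>n y. (of_int \<lfloor>real n / 2 + y * s n\<rfloor> - real n / 2) / s n)"
  define r where "r = (\<lambda>n y. franel_ratio n \<lfloor>real n / 2 + y * s n\<rfloor>)"
  have uy: "\<bar>u n y - y\<bar> \<le> 1 / s n" for n y
    unfolding u_def using s by (intro floor_scaled_diff) auto
  have u2: "- 6 * (u n y)\<^sup>2 = - 6 * (real_of_int \<lfloor>real n / 2 + y * s n\<rfloor> - real n / 2)\<^sup>2 / (real n + 1)" for n y
    unfolding u_def power_divide s by simp
  have int: "has_bochner_integral lborel (\<lambda>y. u n y ^ (2 * j) * r n y)
      ((\<Sum>k\<in>{0..int n}. ((of_int k - real n / 2) / s n) ^ (2 * j) * franel_ratio n k) / s n)" for n
    unfolding u_def r_def using s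
    by (intro has_bochner_integral_floor_step[where
          F = "\<lambda>k. ((of_int k - real n / 2) / s n) ^ (2 * j) * franel_ratio n k"])
       (auto simp: franel_ratio_def)
  have "(\<lambda>n. LINT y|lborel. u n y ^ (2 * j) * r n y) \<longlonglongrightarrow> (LINT y|lborel. y ^ (2 * j) * exp (- 6 * y\<^sup>2))"
  proof (rule integral_dominated_convergence[where
        w = "\<lambda>y. fact j * exp (13 / 2) * sqrt (2 * pi) * std_normal_density y"])
    show "AE y in lborel. (\<lambda>n. u n y ^ (2 * j) * r n y) \<longlonglongrightarrow> y ^ (2 * j) * exp (- 6 * y\<^sup>2)"
    proof (rule AE_I2)
      fix y :: real
      have "(\<lambda>n. 1 / s n) \<longlonglongrightarrow> 0" unfolding s_def by real_asymp
      then have u: "(\<lambda>n. u n y) \<longlonglongrightarrow> y"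
        by (rule LIM_zero_cancel[OF Lim_null_comparison, rotated]) (use uy in auto)
      \<comment> \<open>The Gaussian error is uniform in the index, so it applies at the floor,
        which moves with n.\<close>
      have "(\<lambda>n. r n y - exp (- 6 * (u n y)\<^sup>2)) \<longlonglongrightarrow> 0"
        by (rule Lim_null_comparison[OF _ franel_error_tendsto_0])
           (use franel_ratio_gaussian in \<open>auto simp only: u2 r_def real_norm_def intro!: always_eventually\<close>)
      moreover have "(\<lambda>n. exp (- 6 * (u n y)\<^sup>2)) \<longlonglongrightarrow> exp (- 6 * y\<^sup>2)"
        by (intro tendsto_intros u)
      ultimately have "(\<lambda>n. r n y - exp (- 6 * (u n y)\<^sup>2) + exp (- 6 * (u n y)\<^sup>2)) \<longlonglongrightarrow> 0 + exp (- 6 * y\<^sup>2)"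
        by (rule tendsto_add)
      then have "(\<lambda>n. r n y) \<longlonglongrightarrow> exp (- 6 * y\<^sup>2)" by simp
      then show "(\<lambda>n. u n y ^ (2 * j) * r n y) \<longlonglongrightarrow> y ^ (2 * j) * exp (- 6 * y\<^sup>2)"
        by (intro tendsto_intros u)
    qed
    show "AE y in lborel. norm (u n y ^ (2 * j) * r n y)
        \<le> fact j * exp (13 / 2) * sqrt (2 * pi) * std_normal_density y" for n
    proof (rule AE_I2)
      fix y :: real
      let ?u = "u n y"
      have "1 / s n \<le> 1" using s by simp
      then have "\<bar>y - ?u\<bar> \<le> 1" using uy[of n y] by linarith
      then have "(y - ?u)\<^sup>2 \<le> 1" by (simp add: abs_square_le_1)
      \<comment> \<open>Rounding moves y by at most 1, so decay in \<open>u n y\<close> is converted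
        into decay in y; the inequality is \<open>(y - 2 * ?u)\<^sup>2 \<ge> 0\<close>.\<close>
      moreover have "y\<^sup>2 \<le> 2 * (y - ?u)\<^sup>2 + 2 * ?u\<^sup>2"
        using zero_le_power2[of "y - 2 * ?u"] by (simp add: power2_eq_square algebra_simps)
      ultimately have y: "y\<^sup>2 \<le> 2 + 2 * ?u\<^sup>2" by linarith
      have "r n y \<le> exp (3 / (2 * (real n + 1))) * exp (- 6 * ?u\<^sup>2)"
        unfolding u2 r_def by (rule franel_ratio_le)
      also have "\<dots> \<le> exp (3 / 2) * exp (- 6 * ?u\<^sup>2)"
        by (intro mult_right_mono) (auto simp: divide_simps)
      finally have r: "r n y \<le> exp (3 / 2) * exp (- 6 * ?u\<^sup>2)" .
      have "?u ^ (2 * j) \<le> fact j * exp (?u\<^sup>2)" using power_le_fact_exp[of "?u\<^sup>2" j] by (simp add: power_mult)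
      then have "?u ^ (2 * j) * r n y \<le> fact j * exp (?u\<^sup>2) * (exp (3 / 2) * exp (- 6 * ?u\<^sup>2))"
        using r by (intro mult_mono) (auto simp: r_def franel_ratio_nonneg)
      also have "\<dots> = fact j * exp (3 / 2 - 5 * ?u\<^sup>2)"
        by (simp add: mult.assoc exp_diff[symmetric] exp_add[symmetric] del: exp_diff)
      also have "\<dots> \<le> fact j * exp (13 / 2 + - y\<^sup>2 / 2)"
      proof (intro mult_left_mono iffD2[OF exp_le_cancel_iff])
        \<comment> \<open>From \<open>y\<^sup>2 \<le> 2 + 2 * ?u\<^sup>2\<close> one gets
          \<open>- 5 * ?u\<^sup>2 \<le> 5 - 5 / 2 * y\<^sup>2\<close>, and 13/2 is 3/2 + 5.\<close>
        show "3 / 2 - 5 * ?u\<^sup>2 \<le> 13 / 2 + - y\<^sup>2 / 2"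
          using y zero_le_power2[of y] by linarith
      qed auto
      also have "\<dots> = fact j * exp (13 / 2) * sqrt (2 * pi) * std_normal_density y"
        unfolding exp_add by (simp add: std_normal_density_def)
      finally show "norm (u n y ^ (2 * j) * r n y)
          \<le> fact j * exp (13 / 2) * sqrt (2 * pi) * std_normal_density y"
        by (simp add: r_def franel_ratio_nonneg)
    qed
    show "(\<lambda>y. u n y ^ (2 * j) * r n y) \<in> borel_measurable lborel" for n
      using int[of n] by (auto elim: has_bochner_integral.cases)
  qed auto
  then show ?thesis
    unfolding gaussian_even_moment has_bochner_integral_integral_eq[OF int] s_def .
qed

section \<open>Mean and variance of the Franel coefficients\<close>

lemma sum_franel_ratio:
  "(\<Sum>k\<in>{0..int n}. f k * franel_ratio n k)
    = (\<Sum>k=0..n. f (int k) * franel_coeff n k) / real (n choose (n div 2)) ^ 3"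
proof -
  have "(\<Sum>k\<in>{0..int n}. f k * franel_ratio n k) = (\<Sum>k=0..n. f (int k) * franel_ratio n (int k))"
    by (rule sum.reindex_bij_witness[of _ int nat]) auto
  also have "\<dots> = (\<Sum>k=0..n. f (int k) * franel_coeff n k) / real (n choose (n div 2)) ^ 3"
    by (simp add: franel_ratio_def franel_coeff_def sum_divide_distrib power_divide)
  finally show ?thesis .
qed

lemma pderiv_sum: "pderiv (sum f A) = (\<Sum>x\<in>A. pderiv (f x))"
  using higher_pderiv_sum[of 1 f A] by simp

lemma sum_franel_coeff_pos: "0 < (\<Sum>k=0..n. franel_coeff n k)"
  by (intro sum_pos) (auto simp: franel_coeff_def zero_less_binomial)

lemma norm_coeff_franel:
  "norm_coeff franel_coeff n k = franel_ratio n k / (\<Sum>k\<in>{0..int n}. franel_ratio n k)"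
proof -
  have "(\<Sum>k\<in>{0..int n}. franel_ratio n k)
      = (\<Sum>k=0..n. franel_coeff n k) / real (n choose (n div 2)) ^ 3"
    using sum_franel_ratio[of "\<lambda>_. 1" n] by simp
  then show ?thesis
    by (simp add: norm_coeff_def franel_ratio_def franel_coeff_def power_divide zero_less_binomial)
qed

lemma franel_mean_eq: "franel_mean n = real n / 2"
proof -
  let ?S = "\<Sum>k=0..n. franel_coeff n k"
  let ?M = "\<Sum>k=0..n. real k * franel_coeff n k"
  \<comment> \<open>Reversing the row fixes the coefficients, so the first moment solves
    \<open>?M = n * ?S - ?M\<close>.\<close>
  have "?M = (\<Sum>k=0..n. (real n - real k) * franel_coeff n k)"
    by (rule sum.reindex_bij_witness[of _ "\<lambda>k. n - k" "\<lambda>k. n - k"])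
       (auto simp: franel_coeff_def of_nat_diff binomial_symmetric[symmetric])
  also have "\<dots> = real n * ?S - ?M"
    by (simp add: left_diff_distrib sum_subtractf sum_distrib_left)
  finally have "?M = real n / 2 * ?S" by simp
  moreover have "poly (pderiv (franel_poly n)) 1 = ?M" "poly (franel_poly n) 1 = ?S"
    unfolding franel_poly_def by (simp_all add: pderiv_sum pderiv_monom poly_sum poly_monom)
  ultimately show ?thesis
    using sum_franel_coeff_pos[of n] by (simp add: franel_mean_def)
qed

text \<open>Expanding \<open>k * (k - 1)\<close> around \<open>n / 2\<close> identifies the
  generating-function variance with the second central moment; the central binomial factor cancels
  in the quotient.\<close>

lemma franel_var_eq:
  "franel_var n = (\<Sum>k\<in>{0..int n}. (of_int k - real n / 2)\<^sup>2 * franel_ratio n k)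
    / (\<Sum>k\<in>{0..int n}. franel_ratio n k)"
proof -
  let ?S = "\<Sum>k=0..n. franel_coeff n k"
  let ?M = "\<Sum>k=0..n. real k * franel_coeff n k"
  let ?Q = "\<Sum>k=0..n. (real k - real n / 2)\<^sup>2 * franel_coeff n k"
  have S: "0 < ?S" by (rule sum_franel_coeff_pos)
  have p: "poly (franel_poly n) 1 = ?S" "poly (pderiv (franel_poly n)) 1 = ?M"
    unfolding franel_poly_def by (simp_all add: pderiv_sum pderiv_monom poly_sum poly_monom)
  have M: "?M = real n / 2 * ?S"
    using franel_mean_eq[of n] S p by (simp add: franel_mean_def field_simps)
  have "poly (pderiv (pderiv (franel_poly n))) 1 = (\<Sum>k=0..n. real (k - 1) * (real k * franel_coeff n k))"
    unfolding franel_poly_def by (simp add: pderiv_sum pderiv_monom poly_sum poly_monom)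
  also have "\<dots> = (\<Sum>k=0..n. (real k - real n / 2)\<^sup>2 * franel_coeff n k
      + (real n - 1) * (real k * franel_coeff n k) - (real n)\<^sup>2 / 4 * franel_coeff n k)"
  proof (rule sum.cong[OF refl])
    fix k
    \<comment> \<open>At \<open>k = 0\<close> the truncated subtraction is harmless because of the
      factor k.\<close>
    have "real (k - 1) * real k = (real k - real n / 2)\<^sup>2 + (real n - 1) * real k - (real n)\<^sup>2 / 4"
      by (cases k) (auto simp: power2_eq_square field_simps)
    then show "real (k - 1) * (real k * franel_coeff n k) = (real k - real n / 2)\<^sup>2 * franel_coeff n k
      + (real n - 1) * (real k * franel_coeff n k) - (real n)\<^sup>2 / 4 * franel_coeff n k"
      by (simp only: mult.assoc[symmetric] distrib_right left_diff_distrib)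
  qed
  also have "\<dots> = ?Q + (real n - 1) * ?M - (real n)\<^sup>2 / 4 * ?S"
    by (simp add: sum.distrib sum_subtractf sum_distrib_left)
  finally have "franel_var n = (?Q + (real n - 1) * ?M - (real n)\<^sup>2 / 4 * ?S) / ?S + real n / 2 - (real n / 2)\<^sup>2"
    unfolding franel_var_def franel_mean_eq p by simp
  also have "\<dots> = ?Q / ?S"
    unfolding M using S by (simp add: field_simps power2_eq_square)
  also have "\<dots> = (\<Sum>k\<in>{0..int n}. (of_int k - real n / 2)\<^sup>2 * franel_ratio n k)
    / (\<Sum>k\<in>{0..int n}. 1 * franel_ratio n k)"
    unfolding sum_franel_ratio by (simp add: zero_less_binomial)
  finally show ?thesis by simp
qed

lemma franel_ratio_sum_tendsto:
  "(\<lambda>n. (\<Sum>k\<in>{0..int n}. franel_ratio n k) / sqrt (real n + 1)) \<longlonglongrightarrow> sqrt (pi / 6)"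
  using franel_ratio_moment_tendsto[of 0] by simp

text \<open>Quotient of the moment limits for \<open>j = 1\<close> and \<open>j = 0\<close>: the
  constant is \<open>fact 2 / 24\<close>.\<close>

lemma franel_var_tendsto: "(\<lambda>n. franel_var n / (real n + 1)) \<longlonglongrightarrow> 1 / 12"
proof -
  let ?A = "\<lambda>n. (\<Sum>k\<in>{0..int n}. franel_ratio n k) / sqrt (real n + 1)"
  let ?B = "\<lambda>n. (\<Sum>k\<in>{0..int n}. ((of_int k - real n / 2) / sqrt (real n + 1)) ^ (2 * 1) * franel_ratio n k)
      / sqrt (real n + 1)"
  have "(\<lambda>n. ?B n / ?A n) \<longlonglongrightarrow> sqrt (pi / 6) * (fact (2 * 1) / (24 ^ 1 * fact 1)) / sqrt (pi / 6)"
    by (intro tendsto_divide franel_ratio_moment_tendsto franel_ratio_sum_tendsto) simp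
  moreover have "?B n / ?A n = franel_var n / (real n + 1)" for n
    unfolding franel_var_eq by (simp add: power_divide sum_divide_distrib[symmetric])
  ultimately show ?thesis by simp
qed

section \<open>The local limit theorem for the Franel coefficients\<close>

lemma gaussian_lipschitz:
  fixes u v :: real
  shows "\<bar>exp (- 6 * u\<^sup>2) - exp (- 6 * v\<^sup>2)\<bar> \<le> 6 * \<bar>u - v\<bar>"
proof -
  have "norm (exp (- 6 * u\<^sup>2) - exp (- 6 * v\<^sup>2)) \<le> 6 * norm (u - v)"
  proof (rule field_differentiable_bound[OF convex_UNIV])
    fix z :: real
    show "((\<lambda>z. exp (- 6 * z\<^sup>2)) has_field_derivative - 12 * z * exp (- 6 * z\<^sup>2)) (at z within UNIV)"
      by (auto intro!: derivative_eq_intros)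
    \<comment> \<open>The derivative has modulus
      \<open>12 * \<bar>z\<bar> * exp (- 6 * z\<^sup>2)\<close>, so the Lipschitz constant 6 amounts
      to \<open>2 * \<bar>z\<bar> \<le> exp (6 * z\<^sup>2)\<close>.\<close>
    have "2 * \<bar>z\<bar> \<le> 1 + z\<^sup>2" using zero_le_power2[of "\<bar>z\<bar> - 1"] by (simp add: power2_diff)
    also have "\<dots> \<le> exp (6 * z\<^sup>2)" using exp_ge_add_one_self[of "6 * z\<^sup>2"] zero_le_power2[of z] by linarith
    finally have "2 * \<bar>z\<bar> * exp (- 6 * z\<^sup>2) \<le> exp (6 * z\<^sup>2) * exp (- 6 * z\<^sup>2)"
      by (rule mult_right_mono) simp
    then show "norm (- 12 * z * exp (- 6 * z\<^sup>2)) \<le> 6"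
      by (simp add: abs_mult flip: exp_add)
  qed auto
  then show ?thesis by simp
qed

text \<open>Lipschitz dependence on the rate, uniform in w, because \<open>w * exp (- m * w)\<close>
  is at most \<open>1 / m\<close>. With w the square of x, this compares Gaussians of nearby
  variances uniformly in x.\<close>

lemma exp_minus_mult_diff_le:
  fixes a b m w :: real
  assumes "0 < m" "m \<le> a" "m \<le> b" "0 \<le> w"
  shows "\<bar>exp (- a * w) - exp (- b * w)\<bar> \<le> \<bar>a - b\<bar> / m"
proof -
  have *: "\<bar>exp (- a * w) - exp (- b * w)\<bar> \<le> \<bar>a - b\<bar> / m" if "m \<le> a" "a \<le> b" for a b
  proof -
    have "exp (- a * w) \<le> exp (- m * w)" using that assms by (simp add: mult_right_mono)
    moreover have "1 - exp (- (b - a) * w) \<le> (b - a) * w" using exp_ge_add_one_self[of "- (b - a) * w"] by (simp only: mult_minus_left)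
    moreover have "0 \<le> (b - a) * w" using that assms by simp
    ultimately have "exp (- a * w) * (1 - exp (- (b - a) * w)) \<le> exp (- m * w) * ((b - a) * w)"
      by (meson exp_ge_zero mult_left_mono mult_right_mono order_trans)
    moreover have "exp (- a * w) * exp (- (b - a) * w) = exp (- b * w)"
      by (simp add: algebra_simps flip: exp_add)
    ultimately have "exp (- a * w) - exp (- b * w) \<le> (b - a) * (w * exp (- m * w))"
      by (simp add: algebra_simps)
    also have "\<dots> \<le> (b - a) * (1 / m)"
    proof (rule mult_left_mono)
      have "m * w \<le> exp (m * w)" using exp_ge_add_one_self[of "m * w"] by linarith
      then show "w * exp (- m * w) \<le> 1 / m" using assms by (simp add: exp_minus field_simps)
    qed (use that in simp)
    finally have "exp (- a * w) - exp (- b * w) \<le> \<bar>a - b\<bar> / m" using that by simp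
    moreover have "exp (- b * w) \<le> exp (- a * w)" using that assms by (simp add: mult_right_mono)
    ultimately show ?thesis by simp
  qed
  show ?thesis
  proof (cases "a \<le> b")
    case False
    then show ?thesis using *[of b a] assms by (simp add: abs_minus_commute)
  qed (use * assms in simp)
qed

lemma franel_var_nonneg: "0 \<le> franel_var n"
  unfolding franel_var_eq
  by (intro divide_nonneg_nonneg sum_nonneg mult_nonneg_nonneg) (auto simp: franel_ratio_nonneg)

lemma franel_var_at_top: "filterlim franel_var at_top sequentially"
proof -
  have "filterlim (\<lambda>n. franel_var n / (real n + 1) * (real n + 1)) at_top sequentially"
    by (rule filterlim_tendsto_pos_mult_at_top[OF franel_var_tendsto]) (simp, real_asymp)
  then show ?thesis by (simp add: add_nonneg_eq_0_iff)
qed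

lemma franel_asymp_normal_llt: "asymp_normal_llt franel_coeff franel_mean franel_var"
proof -
  define s where "s = (\<lambda>n. sqrt (real n + 1))"
  define A where "A = (\<lambda>n. \<Sum>k\<in>{0..int n}. franel_ratio n k)"
  define t where "t = (\<lambda>n. sqrt (franel_var n / (real n + 1)))"
  \<comment> \<open>The scaled coefficient \<open>\<sigma> * p\<close> equals
    \<open>\<alpha> n\<close> times the Franel ratio, and \<open>\<alpha>\<close> tends to
    \<open>\<kappa>\<close> since (1/12) / (pi/6) = 1 / (2 pi).\<close>
  define \<alpha> where "\<alpha> = (\<lambda>n. t n / (A n / s n))"
  define \<delta> where "\<delta> = (\<lambda>n. (exp (3 / (2 * (real n + 1))) - 1) + 12 / (real n + 1))"
  define \<kappa> where "\<kappa> = 1 / sqrt (2 * pi)"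
  \<comment> \<open>The inner summands bound the Gaussian approximation, the rounding to an integer,
    and the replacement of the rate \<open>6 * (t n)\<^sup>2\<close> by its limit 1/2; the divisor
    1/4 bounds both rates from below, for large n. The last summand corrects the
    normalisation.\<close>
  define B where "B = (\<lambda>n. \<bar>\<alpha> n\<bar> * (\<delta> n + 6 * (1 / s n) + \<bar>6 * (t n)\<^sup>2 - 1 / 2\<bar> / (1 / 4)) + \<bar>\<alpha> n - \<kappa>\<bar>)"
  have s: "0 < s n" "(s n)\<^sup>2 = real n + 1" for n by (auto simp: s_def)
  have t: "t \<longlonglongrightarrow> sqrt (1 / 12)" unfolding t_def by (intro tendsto_real_sqrt franel_var_tendsto)
  have t2: "(\<lambda>n. 6 * (t n)\<^sup>2) \<longlonglongrightarrow> 1 / 2"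
    using tendsto_mult_left[OF tendsto_power[OF t, of 2], of 6] by simp
  have "\<alpha> \<longlonglongrightarrow> sqrt (1 / 12) / sqrt (pi / 6)"
    unfolding \<alpha>_def A_def s_def by (intro tendsto_divide t franel_ratio_sum_tendsto) simp
  also have "sqrt (1 / 12) / sqrt (pi / 6) = \<kappa>"
    by (simp add: \<kappa>_def flip: real_sqrt_divide real_sqrt_mult) (simp add: real_sqrt_divide)
  finally have \<alpha>: "\<alpha> \<longlonglongrightarrow> \<kappa>" .
  have B: "B \<longlonglongrightarrow> 0"
  proof -
    have "(\<lambda>n. 1 / s n) \<longlonglongrightarrow> 0" unfolding s_def by real_asymp
    then have "B \<longlonglongrightarrow> \<bar>\<kappa>\<bar> * (0 + 6 * 0 + \<bar>1 / 2 - 1 / 2\<bar> / (1 / 4)) + \<bar>\<kappa> - \<kappa>\<bar>"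
      unfolding B_def \<delta>_def by (intro tendsto_intros \<alpha> t2 franel_error_tendsto_0) simp_all
    then show ?thesis by simp
  qed
  show ?thesis unfolding asymp_normal_llt_def
  proof (rule SUP_tendsto_0[OF _ _ B])
    have "\<forall>\<^sub>F n in sequentially. 1 / 4 < 6 * (t n)\<^sup>2"
      by (rule order_tendstoD(1)[OF t2]) simp
    then show "\<forall>\<^sub>F n in sequentially. \<forall>x. llt_error franel_coeff franel_mean franel_var n x \<le> B n"
    proof (eventually_elim, intro allI)
      fix n x assume tn: "1 / 4 < 6 * (t n)\<^sup>2"
      have \<sigma>: "sqrt (franel_var n) = t n * s n"
        by (simp add: t_def s_def real_sqrt_divide)
      define k where "k = \<lfloor>real n / 2 + x * t n * s n\<rfloor>"
      define u where "u = (of_int k - real n / 2) / s n"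
      have u2: "- 6 * u\<^sup>2 = - 6 * (real_of_int k - real n / 2)\<^sup>2 / (real n + 1)"
        unfolding u_def power_divide s by simp
      define r where "r = franel_ratio n k"
      define E where "E = exp (- x\<^sup>2 / 2)"
      have 1: "\<bar>r - exp (- 6 * u\<^sup>2)\<bar> \<le> \<delta> n"
        unfolding r_def u2 \<delta>_def by (rule franel_ratio_gaussian)
      have "\<bar>u - x * t n\<bar> \<le> 1 / s n"
        unfolding u_def k_def by (rule floor_scaled_diff[OF s(1)])
      then have 2: "\<bar>exp (- 6 * u\<^sup>2) - exp (- 6 * (x * t n)\<^sup>2)\<bar> \<le> 6 * (1 / s n)"
        by (intro order_trans[OF gaussian_lipschitz] mult_left_mono) auto
      have 3: "\<bar>exp (- 6 * (x * t n)\<^sup>2) - E\<bar> \<le> \<bar>6 * (t n)\<^sup>2 - 1 / 2\<bar> / (1 / 4)"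
        using exp_minus_mult_diff_le[of "1 / 4" "6 * (t n)\<^sup>2" "1 / 2" "x\<^sup>2"] tn
        by (simp add: E_def power_mult_distrib mult_ac)
      have "\<bar>r - E\<bar> \<le> \<delta> n + 6 * (1 / s n) + \<bar>6 * (t n)\<^sup>2 - 1 / 2\<bar> / (1 / 4)"
        using 1 2 3 by linarith
      then have 4: "\<bar>\<alpha> n * (r - E)\<bar> \<le> \<bar>\<alpha> n\<bar> * (\<delta> n + 6 * (1 / s n) + \<bar>6 * (t n)\<^sup>2 - 1 / 2\<bar> / (1 / 4))"
        unfolding abs_mult by (intro mult_left_mono) auto
      have "E \<le> 1" "0 \<le> E" by (auto simp: E_def)
      then have 5: "\<bar>(\<alpha> n - \<kappa>) * E\<bar> \<le> \<bar>\<alpha> n - \<kappa>\<bar>"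
        by (simp add: abs_mult mult_left_le)
      have "llt_error franel_coeff franel_mean franel_var n x = \<bar>t n * s n * (r / A n) - \<kappa> * E\<bar>"
        unfolding llt_error_def \<sigma> franel_mean_eq norm_coeff_franel r_def A_def k_def E_def \<kappa>_def
        by (simp add: mult.assoc)
      also have "t n * s n * (r / A n) = \<alpha> n * r" by (simp add: \<alpha>_def)
      also have "\<alpha> n * r - \<kappa> * E = \<alpha> n * (r - E) + (\<alpha> n - \<kappa>) * E"
        by (simp add: algebra_simps)
      finally show "llt_error franel_coeff franel_mean franel_var n x \<le> B n"
        using 4 5 unfolding B_def by linarith
    qed
  qed (simp add: llt_error_def)
qed

theorem theorem3p4:
  shows "asymp_normal_llt franel_coeff franel_mean franel_var
    \<and> asymp_normal_clt franel_coeff franel_mean franel_var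
    \<and> franel_mean \<sim>[sequentially] (\<lambda>n. real n / 2)
    \<and> franel_var \<sim>[sequentially] (\<lambda>n. real n / 12)"
proof (intro conjI)
  show llt: "asymp_normal_llt franel_coeff franel_mean franel_var"
    by (rule franel_asymp_normal_llt)
  show "asymp_normal_clt franel_coeff franel_mean franel_var"
    by (rule asymp_normal_clt_if_llt[OF _ franel_var_nonneg franel_var_at_top llt])
       (simp add: franel_coeff_def)
  show "franel_mean \<sim>[sequentially] (\<lambda>n. real n / 2)"
    by (simp add: franel_mean_eq[abs_def])
  have "(\<lambda>n. franel_var n / (real n + 1) * (12 * (real n + 1) / real n)) \<longlonglongrightarrow> 1 / 12 * 12"
    by (intro tendsto_mult franel_var_tendsto) real_asymp
  \<comment> \<open>At \<open>n = 0\<close> both sides are 0, by the convention for division by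
    zero.\<close>
  moreover have "franel_var n / (real n + 1) * (12 * (real n + 1) / real n) = franel_var n / (real n / 12)" for n
    by (simp add: add_nonneg_eq_0_iff del: distrib_left_numeral)
  ultimately have "(\<lambda>n. franel_var n / (real n / 12)) \<longlonglongrightarrow> 1" by simp
  then show "franel_var \<sim>[sequentially] (\<lambda>n. real n / 12)"
    by (rule asymp_equivI') 
qed

end
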